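(* Let $x^*$ be the unique positive real solution of $x=\ln\frac{3}{2+x}$ and let $b=1/x^*\approx 3.62143$. Then global rate-monotonic (RM) scheduling has capacity augmentation factor $b$ for sporadic DAG task systems with implicit deadlines; that is, for every number $M$ of identical processors, every such system satisfying $$\sum_{\tau_i}\frac{C_i}{M\,T_i}\le\frac1b\qquad\text{and}\qquad\max_{\tau_i}\frac{\Psi_i}{T_i}\le\frac1b$$ is schedulable by global RM on $M$ processors.
   Context: A sporadic DAG task $\tau_i$ releases jobs with consecutive releases at least $T_i$ (its period) apart; with implicit deadlines, a job released at $r$ has absolute deadline $r+T_i$. Each job is a directed acyclic graph whose nodes (subtasks) are sequential pieces of execution and whose edges are precedence constraints: a node is ready when all its predecessors have been executed. Different jobs of the same task may have different DAGs, subject to: the total execution time of all nodes of a job of $\tau_i$ is at most $C_i>0$ (work), and the length of a longest (critical) path of a job's DAG, with nodes weighted by execution times, is at most $\Psi_i$, where $\Psi_i\le C_i$. Global RM: priorities are fixed, tasks with smaller periods have higher priority (ties broken arbitrarily), scheduling is preemptive with migration, and at any time the (up to) $M$ highest-priority ready subtasks are executed on the $M$ processors. A task system is schedulable if all jobs of all tasks always finish by their absolute deadlines. *)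

theory Defs
  imports "HOL-Analysis.Analysis"
begin

record dag_task =
  work_bound :: real
  path_bound :: real
  period :: real

definition valid_task :: "dag_task \<Rightarrow> bool" where
  "valid_task \<tau> \<longleftrightarrow> 0 < work_bound \<tau> \<and> 0 < period \<tau> \<and> path_bound \<tau> \<le> work_bound \<tau>"

text \<open>Every job carries its own DAG. Since DAGs are finite, naturals suffice as node names.\<close>

record dag_job =
  release :: real
  nodes :: "nat set"
  edges :: "(nat \<times> nat) set"
  exec :: "nat \<Rightarrow> real"

definition dag_paths :: "dag_job \<Rightarrow> nat list set" where
  "dag_paths j = {p. set p \<subseteq> nodes j \<and> successively (\<lambda>u v. (u, v) \<in> edges j) p}"

definition total_work :: "dag_job \<Rightarrow> real" where
  "total_work j = (\<Sum>v\<in>nodes j. exec j v)"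

text \<open>The empty list counts as a path, so the maximum also makes sense for a DAG without nodes.\<close>

definition critical_path_length :: "dag_job \<Rightarrow> real" where
  "critical_path_length j = Max ((\<lambda>p. sum_list (map (exec j) p)) ` dag_paths j)"

text \<open>Nodes of execution time zero (such as dummy sources and sinks) are allowed.\<close>

definition valid_dag :: "dag_job \<Rightarrow> bool" where
  "valid_dag j \<longleftrightarrow> finite (nodes j) \<and> edges j \<subseteq> nodes j \<times> nodes j \<and> acyclic (edges j) \<and>
     (\<forall>v\<in>nodes j. 0 \<le> exec j v)"

lemma finite_dag_paths:
  assumes "valid_dag j"
  shows "finite (dag_paths j)"
proof -
  have acyc: "acyclic (edges j)" and fin: "finite (nodes j)"
    using assms by (auto simp: valid_dag_def)
  have reach: "(u, v) \<in> (edges j)\<^sup>+"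
    if "successively (\<lambda>u v. (u, v) \<in> edges j) (u # p)" "v \<in> set p" for u v p
    using that
  proof (induction p arbitrary: u)
    case (Cons w p)
    then show ?case
      by (cases "v = w") (auto intro: trancl_into_trancl2)
  qed simp
  have "distinct p" if "successively (\<lambda>u v. (u, v) \<in> edges j) p" for p
    using that
  proof (induction p)
    case (Cons u p)
    then show ?case
      using reach acyc by (auto simp: acyclic_def successively_Cons)
  qed simp
  then have "dag_paths j \<subseteq> {p. set p \<subseteq> nodes j \<and> length p \<le> card (nodes j)}"
    using fin by (auto simp: dag_paths_def) (metis card_mono distinct_card)
  then show ?thesis
    using finite_lists_length_le[OF fin] finite_subset by blast
qed

definition job_of :: "dag_task \<Rightarrow> dag_job \<Rightarrow> bool" where
  "job_of \<tau> j \<longleftrightarrow> valid_dag j \<and> 0 \<le> release j \<and>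
     total_work j \<le> work_bound \<tau> \<and> critical_path_length j \<le> path_bound \<tau>"

text \<open>A task system is a list of tasks. \<open>J i\<close> is the finite or infinite set of jobs released by
  task number \<open>i\<close>; the minimum separation makes distinct jobs of a task have distinct releases.
  Time starts at 0.\<close>

definition legal_arrivals :: "dag_task list \<Rightarrow> (nat \<Rightarrow> dag_job set) \<Rightarrow> bool" where
  "legal_arrivals ts J \<longleftrightarrow> (\<forall>i<length ts.
     (\<forall>j\<in>J i. job_of (ts ! i) j) \<and>
     pairwise (\<lambda>j j'. period (ts ! i) \<le> \<bar>release j - release j'\<bar>) (J i))"

text \<open>A subtask is given by task number, job and node. A schedule maps every time instant to the
  set of subtasks that are being executed; being a set, it runs no subtask on two processors at
  once, and which processor is used is irrelevant because migration is free.\<close>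

type_synonym subtask = "nat \<times> dag_job \<times> nat"
type_synonym schedule = "real \<Rightarrow> subtask set"

definition received :: "schedule \<Rightarrow> subtask \<Rightarrow> real \<Rightarrow> real" where
  "received \<sigma> s t = measure lebesgue {x \<in> {0..t}. s \<in> \<sigma> x}"

text \<open>Readiness refers to all direct and indirect predecessors: a node of execution time zero
  has received its execution time from the outset, but counts as executed only after its own
  predecessors.\<close>

definition ready :: "dag_task list \<Rightarrow> (nat \<Rightarrow> dag_job set) \<Rightarrow> schedule \<Rightarrow> real \<Rightarrow> subtask set" where
  "ready ts J \<sigma> t = {(i, j, v). i < length ts \<and> j \<in> J i \<and> v \<in> nodes j \<and> release j \<le> t \<and>
     (\<forall>u. (u, v) \<in> (edges j)\<^sup>+ \<longrightarrow> exec j u \<le> received \<sigma> (i, j, u) t) \<and>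
     received \<sigma> (i, j, v) t < exec j v}"

definition finished :: "schedule \<Rightarrow> nat \<Rightarrow> dag_job \<Rightarrow> real \<Rightarrow> bool" where
  "finished \<sigma> i j t \<longleftrightarrow> (\<forall>v\<in>nodes j. exec j v \<le> received \<sigma> (i, j, v) t)"

text \<open>\<open>prio i\<close> is the fixed priority of task number \<open>i\<close>; a smaller number means higher priority.\<close>

definition rm_priority :: "dag_task list \<Rightarrow> (nat \<Rightarrow> nat) \<Rightarrow> bool" where
  "rm_priority ts prio \<longleftrightarrow> inj_on prio {..<length ts} \<and>
     (\<forall>i<length ts. \<forall>k<length ts. period (ts ! i) < period (ts ! k) \<longrightarrow> prio i < prio k)"

text \<open>Priorities are per task, so the choice among ready subtasks of one task is arbitrary.\<close>

definition priority_schedule ::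
  "nat \<Rightarrow> dag_task list \<Rightarrow> (nat \<Rightarrow> nat) \<Rightarrow> (nat \<Rightarrow> dag_job set) \<Rightarrow> schedule \<Rightarrow> bool" where
  "priority_schedule M ts prio J \<sigma> \<longleftrightarrow>
     (\<forall>s. {t. s \<in> \<sigma> t} \<in> sets lebesgue) \<and>
     (\<forall>t. \<sigma> t \<subseteq> ready ts J \<sigma> t \<and> card (\<sigma> t) = min M (card (ready ts J \<sigma> t)) \<and>
       (\<forall>s\<in>\<sigma> t. \<forall>s'\<in>ready ts J \<sigma> t - \<sigma> t. prio (fst s) \<le> prio (fst s')))"

definition global_rm_schedulable :: "nat \<Rightarrow> dag_task list \<Rightarrow> bool" where
  "global_rm_schedulable M ts \<longleftrightarrow>
     (\<forall>prio J \<sigma>. rm_priority ts prio \<and> legal_arrivals ts J \<and> priority_schedule M ts prio J \<sigma> \<longrightarrow>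
       (\<forall>i<length ts. \<forall>j\<in>J i. finished \<sigma> i j (release j + period (ts ! i))))"

definition capacity_augmentation_factor :: "(nat \<Rightarrow> dag_task list \<Rightarrow> bool) \<Rightarrow> real \<Rightarrow> bool" where
  "capacity_augmentation_factor schedulable b \<longleftrightarrow>
     (\<forall>M ts. 1 \<le> M \<and> (\<forall>\<tau>\<in>set ts. valid_task \<tau>) \<and>
       (\<Sum>\<tau>\<leftarrow>ts. work_bound \<tau> / (real M * period \<tau>)) \<le> 1 / b \<and>
       (\<forall>\<tau>\<in>set ts. path_bound \<tau> / period \<tau> \<le> 1 / b) \<longrightarrow>
       schedulable M ts)"

definition x_star :: real where
  "x_star = (THE x. 0 < x \<and> x = ln (3 / (2 + x)))"

end

theory Submission
  imports Defs
begin

text \<open>Let a job of task \<open>i\<close> miss its deadline. Some path of its DAG has the property that, whenever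
  no node of it runs, all processors are busy with subtasks of at least the same priority. Counting
  this work, where each higher priority task contributes one carry-in job, gives for every
  \<open>t \<le> T\<^sub>i\<close> the inequality \<open>t < \<Psi>\<^sub>i + C\<^sub>i / M + (\<Sum>h. n\<^sub>h C\<^sub>h) / M\<close>, with \<open>n\<^sub>h = \<lceil>t / T\<^sub>h\<rceil> + 1\<close>. It is used
  only at \<open>t = T\<^sub>i\<close> and at the points \<open>t\<^sub>h = \<lfloor>T\<^sub>i / T\<^sub>h\<rfloor> T\<^sub>h\<close>, where \<open>n\<^sub>h C\<^sub>h / M\<close> is at most \<open>2 u\<^sub>h t\<^sub>h\<close> if
  \<open>t \<le> t\<^sub>h\<close> and at most \<open>3 u\<^sub>h t\<^sub>h\<close> otherwise, for the utilization \<open>u\<^sub>h = C\<^sub>h / (M T\<^sub>h)\<close>. Eliminating the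
  \<open>t\<^sub>h\<close> in increasing order yields \<open>3 < (x + u\<^sub>i + 2) (\<Prod>h. 1 + u\<^sub>h)\<close> for \<open>x = 1 / b\<close>. Since
  \<open>(\<Prod>h. 1 + u\<^sub>h) \<le> exp (x - u\<^sub>i)\<close>, the right-hand side is at most \<open>(x + 2) exp x = 3\<close>.\<close>

section \<open>The constant\<close>

text \<open>The exponential form has a left-hand side that increases strictly for positive
  \<open>x\<close>. It yields uniqueness here and closes the schedulability estimate later.\<close>

lemma fixpoint_iff_exp:
  fixes x :: real
  assumes "0 < x"
  shows "x = ln (3 / (2 + x)) \<longleftrightarrow> (2 + x) * exp x = 3"
proof -
  have "x = ln (3 / (2 + x)) \<longleftrightarrow> exp x = 3 / (2 + x)"
    using assms by (metis add_pos_pos divide_pos_pos exp_ln ln_exp zero_less_numeral)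
  then show ?thesis
    using assms by (simp add: field_simps)
qed

lemma strict_mono_on_add_two_mult_exp:
  fixes x y :: real
  assumes "0 < x" "x < y"
  shows "(2 + x) * exp x < (2 + y) * exp y"
  using assms by (intro mult_strict_mono) auto

text \<open>In the Lagrange remainder the intermediate point \<open>t\<close> satisfies
  \<open>\<bar>t\<bar> \<le> 1\<close>, so its exponential lies between 0 and 3.\<close>

lemma exp_taylor_bounds:
  fixes x :: real
  assumes "0 \<le> x" "x \<le> 1"
  shows "(\<Sum>m<n. x ^ m / fact m) \<le> exp x"
    and "exp x \<le> (\<Sum>m<n. x ^ m / fact m) + 3 * x ^ n / fact n"
proof -
  obtain t where t: "\<bar>t\<bar> \<le> \<bar>x\<bar>"
    and e: "exp x = (\<Sum>m<n. x ^ m / fact m) + exp t / fact n * x ^ n"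
    using Maclaurin_exp_le by blast
  have "exp t \<le> exp 1"
    using t assms by simp
  then have "exp t \<le> 3"
    using exp_le by linarith
  then have "exp t / fact n * x ^ n \<le> 3 / fact n * x ^ n"
    using assms by (intro mult_right_mono divide_right_mono) auto
  then show "exp x \<le> (\<Sum>m<n. x ^ m / fact m) + 3 * x ^ n / fact n"
    using e by simp
  show "(\<Sum>m<n. x ^ m / fact m) \<le> exp x"
    using e assms by simp
qed

text \<open>The argument is \<open>1 / 3.621435\<close>, the reciprocal of the upper end of the
  tolerance interval around 3.62143. The next lemma uses \<open>1 / 3.621425\<close>, from the lower
  end.\<close>

lemma fixpoint_lower:
  "(2 + 200000 / 724287) * exp (200000 / 724287) < (3::real)"
proof -
  \<comment> \<open>This rational is slightly above the exponential, yet small enough to keep the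
    product below 3. Eight Taylor terms leave a remainder below \<open>10^(-8)\<close>.\<close>
  have "exp (200000 / 724287) \<le> (1.3180242::real)"
    using exp_taylor_bounds(2)[of "200000 / 724287" 8]
    by (simp add: eval_nat_numeral fact_numeral)
  then show ?thesis
    by simp
qed

lemma fixpoint_upper:
  "(3::real) < (2 + 200000 / 724285) * exp (200000 / 724285)"
  using exp_taylor_bounds(1)[of "200000 / 724285" 8]
  by (simp add: eval_nat_numeral fact_numeral)

text \<open>The intermediate value theorem on the tiny interval gives existence together with the
  decimal bounds. Monotonicity excludes any other positive solution.\<close>

lemma ex1_fixpoint: "\<exists>!x::real. 0 < x \<and> x = ln (3 / (2 + x))"
  and inverse_x_star_approx: "\<bar>1 / x_star - 3.62143\<bar> < 0.000005"
  and x_star_pos: "0 < x_star"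
  and x_star_exp: "(2 + x_star) * exp x_star = 3"
proof -
  let ?l = "200000 / 724287 :: real" and ?u = "200000 / 724285 :: real"
  have "\<exists>x\<ge>?l. x \<le> ?u \<and> (2 + x) * exp x = 3"
    using fixpoint_lower fixpoint_upper by (intro IVT') (auto intro!: continuous_intros)
  then obtain x where x: "?l \<le> x" "x \<le> ?u" "(2 + x) * exp x = 3"
    by blast
  \<comment> \<open>Neither endpoint solves the equation, which makes the bounds on \<open>x\<close>
    strict.\<close>
  then have "0 < x" "?l \<noteq> x" "x \<noteq> ?u"
    using fixpoint_lower fixpoint_upper by (linarith, (metis less_irrefl)+)
  then have less: "?l < x" "x < ?u"
    using x by auto
  have uniq: "y = x" if "0 < y" "(2 + y) * exp y = 3" for y
    using that x(3) \<open>0 < x\<close> strict_mono_on_add_two_mult_exp[of x y] strict_mono_on_add_two_mult_exp[of y x]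
    by (cases x y rule: linorder_cases) auto
  have sol: "0 < x \<and> x = ln (3 / (2 + x))"
    using \<open>0 < x\<close> x(3) fixpoint_iff_exp[of x] by blast
  show ex1: "\<exists>!x::real. 0 < x \<and> x = ln (3 / (2 + x))"
    using sol uniq fixpoint_iff_exp by blast
  have eq: "x_star = x"
    unfolding x_star_def by (rule the1_equality[OF ex1 sol])
  show "0 < x_star" "(2 + x_star) * exp x_star = 3"
    using eq \<open>0 < x\<close> x(3) by auto
  show "\<bar>1 / x_star - 3.62143\<bar> < 0.000005"
    using less \<open>0 < x\<close> unfolding eq abs_less_iff by (auto simp: field_simps)
qed

section \<open>Utilization bound\<close>

text \<open>The maximum of \<open>t\<close> is removed in each step, so the hypothesis is inherited by the remaining
  indices.\<close>

lemma sum_le_prod_of_demand: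
  fixes t u :: "'a \<Rightarrow> real"
  assumes "finite S" "0 \<le> A" "\<And>j. j \<in> S \<Longrightarrow> 0 \<le> u j"
    and "\<And>j. j \<in> S \<Longrightarrow> t j \<le> A + (\<Sum>i\<in>{i\<in>S. t i < t j}. u i * t i)"
    and "\<And>j. j \<in> S \<Longrightarrow> 0 \<le> t j"
  shows "A + (\<Sum>i\<in>S. u i * t i) \<le> A * (\<Prod>i\<in>S. 1 + u i)"
  using assms
proof (induction S rule: finite_ranking_induct[where f = t])
  case (insert m S)
  have "{i \<in> insert m S. t i < t j} = {i \<in> S. t i < t j}" if "j \<in> S" for j
    using insert.hyps(2)[OF that] by auto
  then have IH: "A + (\<Sum>i\<in>S. u i * t i) \<le> A * (\<Prod>i\<in>S. 1 + u i)"
    using insert.prems(2,4) insert.prems(3)[OF insertI2] insert.prems(1)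
    by (intro insert.IH) auto
  show ?case
  proof (cases "m \<in> S")
    case True
    then show ?thesis
      using IH by (simp add: insert_absorb)
  next
    case False
    have "t m \<le> A + (\<Sum>i\<in>{i\<in>insert m S. t i < t m}. u i * t i)"
      using insert.prems by blast
    also have "\<dots> \<le> A + (\<Sum>i\<in>S. u i * t i)"
      using insert.hyps(1) insert.prems by (intro add_left_mono sum_mono2) auto
    finally have "u m * t m \<le> u m * (A + (\<Sum>i\<in>S. u i * t i))"
      using insert.prems by (intro mult_left_mono) auto
    then have "A + (\<Sum>i\<in>insert m S. u i * t i) \<le> (1 + u m) * (A + (\<Sum>i\<in>S. u i * t i))"
      using False insert.hyps(1) by (simp add: algebra_simps)
    also have "\<dots> \<le> (1 + u m) * (A * (\<Prod>i\<in>S. 1 + u i))"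
      using IH insert.prems by (intro mult_left_mono) auto
    finally show ?thesis
      using False insert.hyps(1) by (simp add: algebra_simps)
  qed
qed simp

lemma prod_one_plus_le_exp:
  fixes u :: "'a \<Rightarrow> real"
  assumes "\<And>i. i \<in> S \<Longrightarrow> 0 \<le> u i"
  shows "(\<Prod>i\<in>S. 1 + u i) \<le> exp (\<Sum>i\<in>S. u i)"
proof (cases "finite S")
  case True
  have "(\<Prod>i\<in>S. 1 + u i) \<le> (\<Prod>i\<in>S. exp (u i))"
    using assms by (intro prod_mono) (auto intro: exp_ge_add_one_self add_nonneg_nonneg)
  then show ?thesis
    using True by (simp add: exp_sum)
\<comment> \<open>For infinite \<open>S\<close> both sides are 1 by convention.\<close>
qed simp

text \<open>The analytic core: \<open>T\<close> is the period of the late job, \<open>w\<close> its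
  utilization and \<open>c\<close> its own contribution to the demand. The sum with factor 2 is the
  same for all \<open>j\<close>, so it joins \<open>c\<close> in the constant \<open>A\<close>, and
  the rest has the form that \<open>sum_le_prod_of_demand\<close> needs.\<close>

lemma demand_contradiction:
  fixes t u :: "'a \<Rightarrow> real"
  assumes fin: "finite S"
    and nonneg: "\<And>j. j \<in> S \<Longrightarrow> 0 \<le> u j" "\<And>j. j \<in> S \<Longrightarrow> 0 \<le> t j"
    and pos: "0 < x" "0 < T" "0 \<le> w" "0 < c"
    and x: "(2 + x) * exp x = 3"
    and c: "c \<le> T * (x + w)"
    and util: "w + (\<Sum>i\<in>S. u i) \<le> x"
    and demand: "\<And>j. j \<in> S \<Longrightarrow>
      t j < c + (\<Sum>i\<in>S. 2 * u i * t i) + (\<Sum>i\<in>{i\<in>S. t i < t j}. u i * t i)"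
    and demand_T: "T < c + (\<Sum>i\<in>S. 3 * u i * t i)"
  shows False
proof -
  define A where "A = c + (\<Sum>i\<in>S. 2 * u i * t i)"
  define G where "G = A + (\<Sum>i\<in>S. u i * t i)"
  define P where "P = (\<Prod>i\<in>S. 1 + u i)"
  have "0 \<le> A"
    unfolding A_def using pos nonneg by (intro add_nonneg_nonneg sum_nonneg) auto
  then have GP: "G \<le> A * P"
    unfolding G_def P_def using fin nonneg demand
    by (intro sum_le_prod_of_demand) (auto simp: A_def less_imp_le)
  \<comment> \<open>Both \<open>A\<close> and \<open>G\<close> are \<open>c\<close> plus a multiple
    of the same sum, with factors 2 and 3. This removes \<open>A\<close>, and bounding
    \<open>c\<close> through \<open>T < G\<close> then lets \<open>G\<close> cancel.\<close>
  have A3: "3 * A = c + 2 * G" and "T < G"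
    using demand_T
    by (auto simp: G_def A_def algebra_simps sum_distrib_left simp flip: sum.distrib)
  have "1 \<le> P"
    unfolding P_def using nonneg by (intro prod_ge_1) auto
  have "3 * G \<le> (c + 2 * G) * P"
    using GP A3 by (metis mult.assoc mult_left_mono zero_le_numeral)
  also have "\<dots> < (G * (x + w) + 2 * G) * P"
  proof -
    have "T * (x + w) < G * (x + w)"
      using \<open>T < G\<close> pos by (intro mult_strict_right_mono) auto
    then show ?thesis
      using c \<open>1 \<le> P\<close> by (intro mult_strict_right_mono) auto
  qed
  also have "\<dots> = G * ((x + w + 2) * P)"
    by (simp add: algebra_simps)
  finally have "3 < (x + w + 2) * P"
    using \<open>T < G\<close> \<open>0 < T\<close> by (simp add: mult.commute)
  also have "\<dots> \<le> (x + w + 2) * exp (x - w)"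
  proof -
    have "P \<le> exp (\<Sum>i\<in>S. u i)"
      unfolding P_def using nonneg by (intro prod_one_plus_le_exp) auto
    also have "\<dots> \<le> exp (x - w)"
      using util by simp
    finally show ?thesis
      using pos by (intro mult_left_mono) auto
  qed
  \<comment> \<open>The case \<open>w = 0\<close> is the worst: the factor \<open>exp w\<close> lost
    from the product outweighs the gain of \<open>w\<close> in the first factor.\<close>
  also have "\<dots> \<le> ((2 + x) * exp w) * exp (x - w)"
  proof -
    have "(2 + x) * (1 + w) \<le> (2 + x) * exp w"
      using pos exp_ge_add_one_self[of w] by (intro mult_left_mono) auto
    moreover have "0 \<le> w * (1 + x)"
      using pos by simp
    ultimately have "x + w + 2 \<le> (2 + x) * exp w"
      by (simp add: algebra_simps)
    then show ?thesis
      by (intro mult_right_mono) auto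
  qed
  also have "\<dots> = 3"
    using x by (simp add: exp_diff)
  finally show False
    by simp
qed

section \<open>Counting\<close>

text \<open>Cut the half-open range into \<open>n\<close> cells of length \<open>d\<close>. Two
  values in one cell would be closer than \<open>d\<close>, so the cell index is injective.\<close>

lemma card_separated_le:
  fixes f :: "'a \<Rightarrow> real"
  assumes d: "0 < d" and sep: "pairwise (\<lambda>x y. d \<le> \<bar>f x - f y\<bar>) S"
    and range: "\<And>x. x \<in> S \<Longrightarrow> a \<le> f x \<and> f x < a + real n * d"
  shows "finite S \<and> card S \<le> n"
proof -
  define g where "g x = nat \<lfloor>(f x - a) / d\<rfloor>" for x
  have ge0: "0 \<le> (f x - a) / d" if "x \<in> S" for x
    using range[OF that] d by simp
  have "inj_on g S"
  proof (rule inj_onI, rule ccontr)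
    fix x y assume xy: "x \<in> S" "y \<in> S" "g x = g y" "x \<noteq> y"
    then have "\<lfloor>(f x - a) / d\<rfloor> = \<lfloor>(f y - a) / d\<rfloor>"
      using ge0[of x] ge0[of y] unfolding g_def
      by (metis eq_nat_nat_iff zero_le_floor)
    then have "\<bar>(f x - a) / d - (f y - a) / d\<bar> < 1"
      by linarith
    then have "\<bar>f x - f y\<bar> < d"
      using d by (simp add: field_simps flip: diff_divide_distrib)
    then show False
      using sep xy unfolding pairwise_def by (meson not_less)
  qed
  moreover have "g ` S \<subseteq> {..<n}"
  proof
    fix k assume "k \<in> g ` S"
    then obtain x where x: "x \<in> S" "k = g x"
      by blast
    have "(f x - a) / d < real n"
      using range[OF x(1)] d by (simp add: field_simps)
    then show "k \<in> {..<n}"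
      using x ge0[OF x(1)] unfolding g_def by (simp add: floor_less_iff nat_less_iff)
  qed
  ultimately show ?thesis
    by (metis card_inj_on_le card_lessThan finite_lessThan inj_on_finite)
qed

text \<open>Integrate the pointwise comparison of \<open>m\<close> times the indicator of
  \<open>B\<close> with the sum of the indicators of the \<open>E s\<close>.\<close>

lemma measure_times_multiplicity_le:
  assumes Q: "finite Q" and E: "\<And>s. s \<in> Q \<Longrightarrow> E s \<in> fmeasurable \<mu>"
    and B: "B \<in> fmeasurable \<mu>"
    and multiplicity: "\<And>x. x \<in> B \<Longrightarrow> m \<le> card {s \<in> Q. x \<in> E s}"
  shows "real m * measure \<mu> B \<le> (\<Sum>s\<in>Q. measure \<mu> (E s))"
proof -
  have int: "integrable \<mu> (indicator (E s) :: _ \<Rightarrow> real)" if "s \<in> Q" for s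
    using E[OF that] by (auto simp: fmeasurable_def)
  have "real m * measure \<mu> B = (\<integral>x. real m * indicator B x \<partial>\<mu>)"
    using B by (simp add: fmeasurable_def)
  also have "\<dots> \<le> (\<integral>x. (\<Sum>s\<in>Q. indicator (E s) x) \<partial>\<mu>)"
  proof (rule integral_mono)
    show "integrable \<mu> (\<lambda>x. real m * indicator B x)"
      using B by (auto simp: fmeasurable_def)
    show "integrable \<mu> (\<lambda>x. \<Sum>s\<in>Q. indicator (E s) x :: real)"
      using int by auto
    fix x
    have "(\<Sum>s\<in>Q. indicator (E s) x :: real) = real (card {s \<in> Q. x \<in> E s})"
      using Q by (simp add: indicator_def Int_def flip: sum.inter_filter)
    then show "real m * indicator B x \<le> (\<Sum>s\<in>Q. indicator (E s) x)"
      using multiplicity by (auto simp: indicator_def)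
  qed
  also have "\<dots> = (\<Sum>s\<in>Q. measure \<mu> (E s))"
    using int E by (subst Bochner_Integration.integral_sum) (auto simp: fmeasurable_def)
  finally show ?thesis .
qed

text \<open>Repetitions only enlarge the right-hand side. Thus paths can be handled as node sets
  without an appeal to their distinctness.\<close>

lemma sum_set_le_sum_list:
  fixes f :: "'a \<Rightarrow> real"
  assumes "\<And>x. x \<in> set xs \<Longrightarrow> 0 \<le> f x"
  shows "sum f (set xs) \<le> sum_list (map f xs)"
  using assms
proof (induction xs)
  case (Cons x xs)
  then show ?case
    by (cases "x \<in> set xs") (auto simp: insert_absorb add_increasing)
qed simp

section \<open>Paths\<close>

text \<open>Readiness refers to indirect predecessors, so a step of the blocking path may span
  several edges. The nodes in between are added as well.\<close>

lemma extend_path_along_trancl: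
  assumes "(u, v) \<in> (edges j)\<^sup>+" "edges j \<subseteq> nodes j \<times> nodes j"
    "p \<in> dag_paths j" "p \<noteq> []" "last p = u"
  shows "\<exists>q\<in>dag_paths j. q \<noteq> [] \<and> last q = v \<and> set p \<subseteq> set q"
  using assms
proof (induction rule: trancl_induct)
  case (base w)
  then show ?case
    by (intro bexI[of _ "p @ [w]"]) (auto simp: dag_paths_def successively_append_iff)
next
  case (step w z)
  then obtain q where "q \<in> dag_paths j" "q \<noteq> []" "last q = w" "set p \<subseteq> set q"
    by blast
  then show ?case
    using step by (intro bexI[of _ "q @ [z]"]) (auto simp: dag_paths_def successively_append_iff)
qed

lemma sum_path_le_critical_path_length:
  assumes "valid_dag j" "p \<in> dag_paths j"
  shows "sum (exec j) (set p) \<le> critical_path_length j"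
proof -
  have "sum (exec j) (set p) \<le> sum_list (map (exec j) p)"
    using assms by (intro sum_set_le_sum_list) (auto simp: dag_paths_def valid_dag_def)
  also have "\<dots> \<le> critical_path_length j"
    unfolding critical_path_length_def using assms finite_dag_paths by (intro Max_ge) auto
  finally show ?thesis .
qed

section \<open>Execution under a priority schedule\<close>

text \<open>The order \<open>prio\<close> is arbitrary here; its rate-monotonic form is assumed only
  where deadlines are proved.\<close>

locale priority_scheduled =
  fixes M :: nat and ts :: "dag_task list" and prio :: "nat \<Rightarrow> nat"
    and J :: "nat \<Rightarrow> dag_job set" and \<sigma> :: schedule
  assumes tasks: "\<forall>\<tau>\<in>set ts. valid_task \<tau>"
    and arrivals: "legal_arrivals ts J"
    and schedule: "priority_schedule M ts prio J \<sigma>"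
begin

lemma period_pos: "i < length ts \<Longrightarrow> 0 < period (ts ! i)"
  using tasks by (simp add: valid_task_def)

lemma job_of_task:
  assumes "i < length ts" "j \<in> J i"
  shows "job_of (ts ! i) j"
  using arrivals assms by (simp add: legal_arrivals_def)

lemma job_valid_dag:
  assumes "i < length ts" "j \<in> J i"
  shows "valid_dag j"
  using job_of_task[OF assms] by (simp add: job_of_def)

lemma releases_separated:
  "i < length ts \<Longrightarrow> pairwise (\<lambda>j j'. period (ts ! i) \<le> \<bar>release j - release j'\<bar>) (J i)"
  using arrivals by (simp add: legal_arrivals_def)

lemma running_ready: "s \<in> \<sigma> x \<Longrightarrow> s \<in> ready ts J \<sigma> x"
  using schedule by (auto simp: priority_schedule_def)

lemma running_measurable [measurable]: "{x. s \<in> \<sigma> x} \<in> sets lebesgue"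
  using schedule unfolding priority_schedule_def by blast

lemma running_fmeasurable:
  assumes "I \<in> lmeasurable"
  shows "{x \<in> I. s \<in> \<sigma> x} \<in> lmeasurable"
  using fmeasurable_Int_fmeasurable[OF assms running_measurable[of s]] by (simp add: Int_def)

section \<open>Received service as a function of time\<close>

lemma received_mono:
  assumes "a \<le> b"
  shows "received \<sigma> s a \<le> received \<sigma> s b"
  unfolding received_def using assms
  by (intro measure_mono_fmeasurable fmeasurableD running_fmeasurable) auto

lemma received_le_add:
  assumes "a \<le> b"
  shows "received \<sigma> s b \<le> received \<sigma> s a + (b - a)"
proof -
  have "received \<sigma> s b \<le> measure lebesgue ({x \<in> {0..a}. s \<in> \<sigma> x} \<union> {a..b})"
    unfolding received_def
    by (intro measure_mono_fmeasurable fmeasurableD running_fmeasurable fmeasurable.Un) auto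
  also have "\<dots> \<le> received \<sigma> s a + measure lebesgue {a..b}"
    unfolding received_def
    by (intro measure_Un_le fmeasurableD running_fmeasurable) auto
  finally show ?thesis
    using assms by simp
qed

lemma continuous_on_received: "continuous_on UNIV (received \<sigma> s)"
proof -
  have "dist (received \<sigma> s a) (received \<sigma> s b) \<le> 1 * dist a b" for a b
    using received_mono[of a b s] received_le_add[of a b s]
      received_mono[of b a s] received_le_add[of b a s]
    by (cases "a \<le> b") (auto simp: dist_real_def)
  then show ?thesis
    by (intro lipschitz_on_continuous_on[of 1] lipschitz_onI) auto
qed

text \<open>By continuity there would be a time \<open>y\<close> at which the service equals the
  execution time exactly. A running subtask is ready and so has received less; hence it never runs
  after \<open>y\<close>, and its service cannot grow further.\<close>

lemma received_le_exec:
  assumes "0 \<le> exec j v"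
  shows "received \<sigma> (i, j, v) t \<le> exec j v"
proof (rule ccontr)
  let ?F = "received \<sigma> (i, j, v)"
  assume "\<not> ?thesis"
  then have gt: "exec j v < ?F t"
    by simp
  have "0 \<le> t"
  proof (rule ccontr)
    assume "\<not> 0 \<le> t"
    then show False
      using gt assms by (simp add: received_def)
  qed
  have "?F 0 \<le> measure lebesgue {0..0::real}"
    unfolding received_def
    by (intro measure_mono_fmeasurable fmeasurableD running_fmeasurable lmeasurable_interval) auto
  then have "?F 0 \<le> exec j v"
    using assms by simp
  then obtain y where y: "0 \<le> y" "y \<le> t" "?F y = exec j v"
    using IVT'[of ?F 0 "exec j v" t] gt \<open>0 \<le> t\<close> continuous_on_received continuous_on_subset
    by (metis less_imp_le subset_UNIV)
  have "x \<le> y" if "(i, j, v) \<in> \<sigma> x" for x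
  proof (rule ccontr)
    assume "\<not> x \<le> y"
    then have "?F y \<le> ?F x"
      by (intro received_mono) simp
    then show False
      using running_ready[OF that] y(3) by (simp add: ready_def)
  qed
  then have "?F t \<le> ?F y"
    unfolding received_def
    by (intro measure_mono_fmeasurable fmeasurableD running_fmeasurable) auto
  then show False
    using gt y(3) by simp
qed

section \<open>Ready subtasks and blocking paths\<close>

text \<open>Separation leaves finitely many releases up to \<open>t\<close>. Finiteness is what
  makes the cardinalities in \<open>priority_schedule\<close> comparable, as an infinite set has
  \<open>card\<close> 0.\<close>

lemma finite_ready: "finite (ready ts J \<sigma> t)"
proof -
  have fin: "finite {j \<in> J i. release j \<le> t}" if i: "i < length ts" for i
  proof -
    obtain n where n: "(t + 1) / period (ts ! i) < real n"
      using reals_Archimedean2 by blast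
    have "finite {j \<in> J i. release j \<le> t} \<and> card {j \<in> J i. release j \<le> t} \<le> n"
    proof (rule card_separated_le[OF period_pos[OF i], where a = 0])
      show "pairwise (\<lambda>j j'. period (ts ! i) \<le> \<bar>release j - release j'\<bar>) {j \<in> J i. release j \<le> t}"
        using releases_separated[OF i] by (rule pairwise_subset) auto
      show "0 \<le> release j \<and> release j < 0 + real n * period (ts ! i)"
        if "j \<in> {j \<in> J i. release j \<le> t}" for j
        using that n job_of_task[OF i, of j] period_pos[OF i]
        by (auto simp: job_of_def field_simps)
    qed
    then show ?thesis ..
  qed
  have "ready ts J \<sigma> t \<subseteq> (SIGMA i:{..<length ts}. SIGMA j:{j \<in> J i. release j \<le> t}. nodes j)"
    by (auto simp: ready_def)
  moreover have "finite \<dots>"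
    using fin job_valid_dag by (intro finite_SigmaI) (auto simp: valid_dag_def)
  ultimately show ?thesis
    by (rule finite_subset)
qed

text \<open>The path is built backwards: before \<open>v\<close> becomes ready, it follows the predecessor of \<open>v\<close>
  that is completed last.\<close>

lemma blocking_path:
  assumes i: "i < length ts" and j: "j \<in> J i" and v: "v \<in> nodes j"
  shows "\<exists>p\<in>dag_paths j. p \<noteq> [] \<and> last p = v \<and>
    (\<forall>t\<ge>release j. received \<sigma> (i, j, v) t < exec j v \<longrightarrow>
      (\<exists>u\<in>set p. (i, j, u) \<in> \<sigma> t) \<or> (card (\<sigma> t) = M \<and> (\<forall>s\<in>\<sigma> t. prio (fst s) \<le> prio i)))"
proof -
  have dag: "finite (nodes j)" "edges j \<subseteq> nodes j \<times> nodes j" "acyclic (edges j)"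
    using job_valid_dag[OF i j] by (auto simp: valid_dag_def)
  then have "finite (edges j)"
    using finite_subset by fastforce
  \<comment> \<open>Induction along the transitive closure makes the hypothesis available for
    indirect predecessors too.\<close>
  then have "wf ((edges j)\<^sup>+)"
    using dag finite_acyclic_wf wf_trancl by blast
  then show ?thesis
    using v
  proof (induction v rule: wf_induct_rule)
    case (less v)
    \<comment> \<open>\<open>A u\<close> collects the times from the release on at which
      \<open>u\<close> is incomplete, whether or not it is ready.\<close>
    define A where "A u = {t. release j \<le> t \<and> received \<sigma> (i, j, u) t < exec j u}" for u
    define D where "D = {u. (u, v) \<in> (edges j)\<^sup>+}"
    have D_nodes: "D \<subseteq> nodes j"
      unfolding D_def using trancl_subset_Sigma[OF dag(2)] by auto
    have running: "(i, j, v) \<in> \<sigma> t \<or> (card (\<sigma> t) = M \<and> (\<forall>s\<in>\<sigma> t. prio (fst s) \<le> prio i))"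
      if "t \<in> A v" "\<forall>u\<in>D. t \<notin> A u" for t
    proof -
      have rdy: "(i, j, v) \<in> ready ts J \<sigma> t"
        using that i j less.prems by (auto simp: ready_def A_def D_def not_less)
      have sub: "\<sigma> t \<subseteq> ready ts J \<sigma> t" and card: "card (\<sigma> t) = min M (card (ready ts J \<sigma> t))"
        and prio: "\<forall>s\<in>\<sigma> t. \<forall>s'\<in>ready ts J \<sigma> t - \<sigma> t. prio (fst s) \<le> prio (fst s')"
        using schedule by (auto simp: priority_schedule_def)
      show ?thesis
      proof (cases "(i, j, v) \<in> \<sigma> t")
        case False
        \<comment> \<open>A ready subtask is left out, so the minimum in the schedule's cardinality
          is attained by \<open>M\<close>.\<close>
        then have "card (\<sigma> t) < card (ready ts J \<sigma> t)"
          using rdy sub finite_ready by (intro psubset_card_mono) auto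
        then have "card (\<sigma> t) = M"
          using card by simp
        then show ?thesis
          using prio rdy False by (metis DiffI fst_conv)
      qed simp
    qed
    show ?case
    proof (cases "D = {}")
      case True
      then show ?thesis
        using running less.prems
        by (intro bexI[of _ "[v]"]) (auto simp: A_def dag_paths_def)
    next
      case False
      \<comment> \<open>Service is monotone, so each such set is an initial segment of the times
        from the release on. A maximal one is therefore greatest and belongs to a predecessor
        completed last.\<close>
      have chain: "A u \<subseteq> A w \<or> A w \<subseteq> A u" for u w
      proof (rule ccontr)
        assume "\<not> ?thesis"
        then obtain a b where ab: "a \<in> A u" "a \<notin> A w" "b \<in> A w" "b \<notin> A u"
          by blast
        then show False
          using received_mono[of a b "(i, j, w)"] received_mono[of b a "(i, j, u)"]
          unfolding A_def by (cases "a \<le> b") auto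
      qed
      have "finite (A ` D)" "A ` D \<noteq> {}"
        using D_nodes dag(1) finite_subset False by auto
      then obtain m where m: "m \<in> A ` D" "\<forall>a\<in>A ` D. m \<subseteq> a \<longrightarrow> m = a"
        using finite_has_maximal by metis
      then obtain u where u: "u \<in> D" "m = A u"
        by blast
      have max: "A w \<subseteq> A u" if "w \<in> D" for w
        using m u that chain[of u w] by auto
      obtain p where p: "p \<in> dag_paths j" "p \<noteq> []" "last p = u"
        "\<forall>t\<in>A u. (\<exists>w\<in>set p. (i, j, w) \<in> \<sigma> t) \<or>
          (card (\<sigma> t) = M \<and> (\<forall>s\<in>\<sigma> t. prio (fst s) \<le> prio i))"
        using less.IH[of u] u D_nodes unfolding D_def A_def by blast
      obtain q where q: "q \<in> dag_paths j" "q \<noteq> []" "last q = v" "set p \<subseteq> set q"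
        using extend_path_along_trancl[OF _ dag(2) p(1,2,3)] u unfolding D_def by blast
      have "(\<exists>w\<in>set q. (i, j, w) \<in> \<sigma> t) \<or> (card (\<sigma> t) = M \<and> (\<forall>s\<in>\<sigma> t. prio (fst s) \<le> prio i))"
        if "t \<in> A v" for t
      proof (cases "t \<in> A u")
        case True
        then show ?thesis
          using p(4) q(4) by blast
      next
        case False
        then show ?thesis
          using running[OF that] max last_in_set[OF q(2)] q(3) by blast
      qed
      then show ?thesis
        using q unfolding A_def by blast
    qed
  qed
qed

section \<open>Demand in the window of an unfinished job\<close>

lemma finished_not_running:
  assumes "finished \<sigma> i j a" "a \<le> x"
  shows "(i, j, v) \<notin> \<sigma> x"
proof
  assume "(i, j, v) \<in> \<sigma> x"
  then have "v \<in> nodes j" "received \<sigma> (i, j, v) x < exec j v"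
    using running_ready by (auto simp: ready_def)
  then show False
    using assms received_mono[OF assms(2), of "(i, j, v)"] by (force simp: finished_def)
qed

text \<open>The window splits into \<open>U\<close>, where some path node runs, and
  \<open>B\<close>, where all \<open>M\<close> processors are busy. \<open>U\<close> is shorter than
  the path; the work in \<open>B\<close> comes from \<open>Q1\<close>, the other nodes of the job,
  and from \<open>Q2\<close>, higher priority jobs.\<close>

lemma unfinished_demand:
  assumes prio_inj: "inj_on prio {..<length ts}"
    and i: "i < length ts" and j: "j \<in> J i"
    and t: "0 < t" "t \<le> period (ts ! i)"
    and unfinished: "\<not> finished \<sigma> i j (release j + t)"
    and own: "\<And>j'. j' \<in> J i \<Longrightarrow> release j' < release j \<Longrightarrow>
      finished \<sigma> i j' (release j' + period (ts ! i))"
    and higher: "\<And>h j'. h < length ts \<Longrightarrow> prio h < prio i \<Longrightarrow> j' \<in> J h \<Longrightarrow>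
      finished \<sigma> h j' (release j' + period (ts ! h))"
    and n: "\<And>h. h < length ts \<Longrightarrow> prio h < prio i \<Longrightarrow>
      t + period (ts ! h) \<le> real (n h) * period (ts ! h)"
    and M: "1 \<le> M"
  shows "real M * t < real M * path_bound (ts ! i) + work_bound (ts ! i) +
    (\<Sum>h | h < length ts \<and> prio h < prio i. real (n h) * work_bound (ts ! h))"
proof -
  define r where "r = release j"
  define H where "H = {h. h < length ts \<and> prio h < prio i}"
  define I where "I = {r..<r + t}"
  define E where "E s = {x \<in> I. s \<in> \<sigma> x}" for s
  obtain v where v: "v \<in> nodes j" "received \<sigma> (i, j, v) (r + t) < exec j v"
    using unfinished by (auto simp: finished_def r_def not_le)
  obtain p where p: "p \<in> dag_paths j" "p \<noteq> []" "last p = v"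
    and block: "\<And>x. r \<le> x \<Longrightarrow> received \<sigma> (i, j, v) x < exec j v \<Longrightarrow>
      (\<exists>u\<in>set p. (i, j, u) \<in> \<sigma> x) \<or> (card (\<sigma> x) = M \<and> (\<forall>s\<in>\<sigma> x. prio (fst s) \<le> prio i))"
    using blocking_path[OF i j v(1)] unfolding r_def by blast
  define U where "U = (\<Union>u\<in>set p. E (i, j, u))"
  define B where "B = I - U"
  \<comment> \<open>A job released at or before \<open>r - period (ts ! h)\<close> has finished by
    \<open>r\<close>, so at most one carry-in job per task remains.\<close>
  define jobs where "jobs h = {j' \<in> J h. r - period (ts ! h) < release j' \<and> release j' < r + t}" for h
  define Q1 where "Q1 = {i} \<times> {j} \<times> (nodes j - set p)"
  define Q2 where "Q2 = (SIGMA h:H. SIGMA j':jobs h. nodes j')"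
  have job: "valid_dag j" "0 \<le> r" "total_work j \<le> work_bound (ts ! i)"
    "critical_path_length j \<le> path_bound (ts ! i)"
    using job_of_task[OF i j] by (auto simp: job_of_def r_def)
  have exec_nonneg: "0 \<le> exec j' u" if "h < length ts" "j' \<in> J h" "u \<in> nodes j'" for h j' u
    using job_valid_dag[OF that(1,2)] that(3) by (auto simp: valid_dag_def)
  have p_nodes: "set p \<subseteq> nodes j"
    using p by (auto simp: dag_paths_def)
  have fin_nodes: "finite (nodes j)"
    using job by (simp add: valid_dag_def)
  have I_meas: "I \<in> lmeasurable" "measure lebesgue I = t"
    using t by (auto simp: I_def intro: bounded_set_imp_lmeasurable)
  have E_meas: "E s \<in> lmeasurable" for s
    unfolding E_def by (rule running_fmeasurable[OF I_meas(1)])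
  have E_le_received: "measure lebesgue (E s) \<le> received \<sigma> s (r + t)" for s
    unfolding E_def received_def using job(2)
    by (intro measure_mono_fmeasurable fmeasurableD running_fmeasurable I_meas) (auto simp: I_def)
  have E_le_exec: "measure lebesgue (E (h, j', u)) \<le> exec j' u"
    if "h < length ts" "j' \<in> J h" "u \<in> nodes j'" for h j' u
    using E_le_received received_le_exec[OF exec_nonneg[OF that]] order_trans by blast
  have U_meas: "U \<in> lmeasurable" and B_meas: "B \<in> lmeasurable"
    unfolding B_def U_def using E_meas I_meas
    by (auto intro!: fmeasurable.finite_UN fmeasurable.Diff)
  have jobs: "finite (jobs h) \<and> card (jobs h) \<le> n h" if h: "h \<in> H" for h
  proof (rule card_separated_le[where f = release and d = "period (ts ! h)" and a = "r - period (ts ! h)"])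
    show "0 < period (ts ! h)"
      using h period_pos by (simp add: H_def)
    show "pairwise (\<lambda>j j'. period (ts ! h) \<le> \<bar>release j - release j'\<bar>) (jobs h)"
      using releases_separated[of h] h by (auto simp: H_def jobs_def intro: pairwise_subset)
    show "r - period (ts ! h) \<le> release j' \<and>
        release j' < r - period (ts ! h) + real (n h) * period (ts ! h)"
      if "j' \<in> jobs h" for j'
      using that n[of h] h by (auto simp: jobs_def H_def)
  qed
  have fin: "finite H" "finite Q1" "finite Q2"
    unfolding Q1_def Q2_def using fin_nodes jobs job_valid_dag
    by (auto simp: H_def jobs_def valid_dag_def intro!: finite_SigmaI)
  \<comment> \<open>The last path node \<open>v\<close> is still incomplete at \<open>r + t\<close>;
    this is the source of the strict inequality.\<close>
  have U_less: "measure lebesgue U < sum (exec j) (set p)"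
  proof -
    have "measure lebesgue U \<le> (\<Sum>u\<in>set p. measure lebesgue (E (i, j, u)))"
      unfolding U_def using E_meas by (intro measure_UNION_le) auto
    also have "\<dots> < sum (exec j) (set p)"
    proof (rule sum_strict_mono_ex1)
      show "\<forall>u\<in>set p. measure lebesgue (E (i, j, u)) \<le> exec j u"
        using E_le_exec[OF i j] p_nodes by blast
      show "\<exists>u\<in>set p. measure lebesgue (E (i, j, u)) < exec j u"
        using E_le_received v(2) last_in_set[OF p(2)] p(3) le_less_trans by blast
    qed simp
    finally show ?thesis .
  qed
  have busy: "M \<le> card {s \<in> Q1 \<union> Q2. x \<in> E s}" if x: "x \<in> B" for x
  proof -
    have xI: "r \<le> x" "x < r + t" "x \<notin> U"
      using x by (auto simp: B_def I_def)
    then have "received \<sigma> (i, j, v) x < exec j v"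
      using v(2) received_mono[of x "r + t" "(i, j, v)"] by simp
    moreover have no_path: "(i, j, u) \<notin> \<sigma> x" if "u \<in> set p" for u
      using xI that by (auto simp: U_def E_def I_def)
    ultimately have card: "card (\<sigma> x) = M" and prio: "\<And>s. s \<in> \<sigma> x \<Longrightarrow> prio (fst s) \<le> prio i"
      using block[OF xI(1)] by blast+
    have "\<sigma> x \<subseteq> {s \<in> Q1 \<union> Q2. x \<in> E s}"
    proof
      fix s assume s: "s \<in> \<sigma> x"
      obtain h j' u where hju: "s = (h, j', u)"
        by (metis prod_cases3)
      have rdy: "h < length ts" "j' \<in> J h" "u \<in> nodes j'" "release j' \<le> x"
        using running_ready[OF s] by (auto simp: ready_def hju)
      have current: "r < release j' + period (ts ! h)"
        if "finished \<sigma> h j' (release j' + period (ts ! h))"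
        using finished_not_running[OF that, of x u] s xI hju by fastforce
      have "s \<in> Q1 \<union> Q2"
      proof (cases "h = i")
        case True
        \<comment> \<open>An earlier job of the task has finished by \<open>r\<close>, and a later
          one is not released before \<open>r + t\<close>, since \<open>t\<close> is at most the
          period.\<close>
        have "j' = j"
        proof (rule ccontr)
          assume "j' \<noteq> j"
          then have sep: "period (ts ! i) \<le> \<bar>release j' - r\<bar>"
            using releases_separated[OF i] rdy True j by (auto simp: pairwise_def r_def)
          then have "release j' < r"
            using rdy xI t by auto
          then show False
            using sep current own[of j'] rdy True by (auto simp: r_def)
        qed
        then show ?thesis
          using True no_path s rdy hju by (auto simp: Q1_def)
      next
        case False
        then have "prio h \<noteq> prio i"
          using prio_inj rdy i by (auto simp: inj_on_def)
        then have "prio h < prio i"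
          using prio[OF s] hju by simp
        then show ?thesis
          using current higher[of h j'] rdy xI by (auto simp: Q2_def H_def jobs_def hju)
      qed
      then show "s \<in> {s \<in> Q1 \<union> Q2. x \<in> E s}"
        using s xI by (simp add: E_def I_def)
    qed
    then show ?thesis
      using card card_mono[of "{s \<in> Q1 \<union> Q2. x \<in> E s}" "\<sigma> x"] fin by simp
  qed
  have "real M * measure lebesgue B \<le> (\<Sum>s\<in>Q1 \<union> Q2. measure lebesgue (E s))"
    using fin E_meas B_meas busy by (intro measure_times_multiplicity_le) auto
  also have "\<dots> \<le> (\<Sum>s\<in>Q1. measure lebesgue (E s)) + (\<Sum>s\<in>Q2. measure lebesgue (E s))"
    using fin sum.union_inter[of Q1 Q2 "\<lambda>s. measure lebesgue (E s)"]
      sum_nonneg[of "Q1 \<inter> Q2" "\<lambda>s. measure lebesgue (E s)"] by simp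
  also have "\<dots> \<le> (\<Sum>(h, j', u)\<in>Q1. exec j' u) + (\<Sum>(h, j', u)\<in>Q2. exec j' u)"
    using E_le_exec i j by (intro add_mono sum_mono) (auto simp: Q1_def Q2_def H_def jobs_def)
  also have "(\<Sum>(h, j', u)\<in>Q1. exec j' u) = (\<Sum>u\<in>nodes j - set p. exec j u)"
    unfolding Q1_def by (simp add: sum.cartesian_product[symmetric])
  also have "\<dots> = total_work j - sum (exec j) (set p)"
    unfolding total_work_def using fin_nodes p_nodes by (intro sum_diff) auto
  also have "(\<Sum>(h, j', u)\<in>Q2. exec j' u) = (\<Sum>h\<in>H. \<Sum>j'\<in>jobs h. total_work j')"
  proof -
    have fin_jobs: "finite (jobs h)" if "h \<in> H" for h
      using jobs[OF that] by simp
    have fin_nodes: "finite (nodes j')" if "h \<in> H" "j' \<in> jobs h" for h j'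
      using that job_valid_dag by (auto simp: H_def jobs_def valid_dag_def)
    have "(\<Sum>(h, j', u)\<in>Q2. exec j' u) =
        (\<Sum>h\<in>H. \<Sum>(j', u)\<in>(SIGMA j':jobs h. nodes j'). exec j' u)"
      unfolding Q2_def using fin fin_jobs fin_nodes by (subst sum.Sigma) auto
    also have "\<dots> = (\<Sum>h\<in>H. \<Sum>j'\<in>jobs h. \<Sum>u\<in>nodes j'. exec j' u)"
      using fin_jobs fin_nodes by (intro sum.cong refl sum.Sigma[symmetric]) auto
    finally show ?thesis
      by (simp add: total_work_def)
  qed
  also have "\<dots> \<le> (\<Sum>h\<in>H. real (n h) * work_bound (ts ! h))"
  proof (rule sum_mono)
    fix h assume h: "h \<in> H"
    have "(\<Sum>j'\<in>jobs h. total_work j') \<le> real (card (jobs h)) * work_bound (ts ! h)"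
      using h job_of_task by (intro sum_bounded_above) (auto simp: jobs_def H_def job_of_def)
    also have "\<dots> \<le> real (n h) * work_bound (ts ! h)"
      using jobs[OF h] h tasks by (intro mult_right_mono) (auto simp: H_def valid_task_def less_imp_le)
    finally show "(\<Sum>j'\<in>jobs h. total_work j') \<le> real (n h) * work_bound (ts ! h)" .
  qed
  finally have B_le: "real M * measure lebesgue B \<le> work_bound (ts ! i) - sum (exec j) (set p) +
      (\<Sum>h\<in>H. real (n h) * work_bound (ts ! h))"
    using job(3) by linarith
  have "measure lebesgue B = t - measure lebesgue U"
  proof -
    have "U \<subseteq> I"
      by (auto simp: U_def E_def)
    then show ?thesis
      unfolding B_def using I_meas U_meas by (simp add: measurable_measure_Diff fmeasurableD)
  qed
  then have "real M * t = real M * measure lebesgue U + real M * measure lebesgue B"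
    by (simp add: right_diff_distrib)
  also have "\<dots> < real M * sum (exec j) (set p) + real M * measure lebesgue B"
    using U_less M by simp
  also have "\<dots> \<le> real M * path_bound (ts ! i) + work_bound (ts ! i) +
      (\<Sum>h\<in>H. real (n h) * work_bound (ts ! h))"
  proof -
    have "sum (exec j) (set p) \<le> path_bound (ts ! i)"
      using sum_path_le_critical_path_length[OF job(1) p(1)] job(4) by simp
    then have "real M * sum (exec j) (set p) \<le> real M * path_bound (ts ! i)"
      by (intro mult_left_mono) auto
    \<comment> \<open>This allows dropping the path work subtracted in \<open>B_le\<close>.\<close>
    moreover have "0 \<le> sum (exec j) (set p)"
      using exec_nonneg[OF i j] p_nodes by (intro sum_nonneg) auto
    ultimately show ?thesis
      using B_le by linarith
  qed
  finally show ?thesis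
    by (simp add: H_def)
qed

section \<open>Deadlines under rate-monotonic priorities\<close>

lemma meets_deadline:
  assumes rm: "rm_priority ts prio" and M: "1 \<le> M"
    and util: "(\<Sum>\<tau>\<leftarrow>ts. work_bound \<tau> / (real M * period \<tau>)) \<le> x_star"
    and paths: "\<forall>\<tau>\<in>set ts. path_bound \<tau> / period \<tau> \<le> x_star"
    and i: "i < length ts" and j: "j \<in> J i"
    and own: "\<And>j'. j' \<in> J i \<Longrightarrow> release j' < release j \<Longrightarrow>
      finished \<sigma> i j' (release j' + period (ts ! i))"
    and higher: "\<And>h j'. h < length ts \<Longrightarrow> prio h < prio i \<Longrightarrow> j' \<in> J h \<Longrightarrow>
      finished \<sigma> h j' (release j' + period (ts ! h))"
  shows "finished \<sigma> i j (release j + period (ts ! i))"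
proof (rule ccontr)
  assume miss: "\<not> ?thesis"
  define H where "H = {h. h < length ts \<and> prio h < prio i}"
  define T where "T = period (ts ! i)"
  define m where "m h = nat \<lfloor>T / period (ts ! h)\<rfloor>" for h
  \<comment> \<open>\<open>a h\<close> is the last multiple of the period of \<open>h\<close> that
    does not exceed \<open>T\<close>.\<close>
  define a where "a h = real (m h) * period (ts ! h)" for h
  define u where "u h = work_bound (ts ! h) / (real M * period (ts ! h))" for h
  define c where "c = path_bound (ts ! i) + work_bound (ts ! i) / real M"
  have inj: "inj_on prio {..<length ts}"
    using rm by (simp add: rm_priority_def)
  have pos: "0 < period (ts ! h)" "0 < work_bound (ts ! h)" if "h < length ts" for h
    using that tasks by (auto simp: valid_task_def)
  have T: "0 < T"
    using pos[OF i] by (simp add: T_def)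
  \<comment> \<open>By the rate-monotonic order, at least one whole period of each higher priority
    task fits into \<open>T\<close>, whence \<open>1 \<le> m h\<close>.\<close>
  have le_T: "period (ts ! h) \<le> T" if "h \<in> H" for h
    using rm that i unfolding H_def T_def rm_priority_def by (metis mem_Collect_eq not_less order_less_asym)
  have m: "1 \<le> m h" "a h \<le> T" "T < a h + period (ts ! h)" if "h \<in> H" for h
  proof -
    have p: "0 < period (ts ! h)"
      using that pos by (simp add: H_def)
    have "1 \<le> T / period (ts ! h)"
      using le_T[OF that] p by simp
    then have fl: "1 \<le> \<lfloor>T / period (ts ! h)\<rfloor>"
      by simp
    then show "1 \<le> m h"
      unfolding m_def by linarith
    have "real (m h) = real_of_int \<lfloor>T / period (ts ! h)\<rfloor>"
      using fl by (simp add: m_def)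
    then have "real (m h) \<le> T / period (ts ! h)" "T / period (ts ! h) < real (m h) + 1"
      by linarith+
    then show "a h \<le> T" "T < a h + period (ts ! h)"
      using p by (auto simp: a_def field_simps)
  qed
  have u_a: "real M * u h * a h = real (m h) * work_bound (ts ! h)" if "h \<in> H" for h
    using that M pos[of h] by (simp add: u_def a_def H_def)
  have u_nonneg: "0 \<le> u h" if "h < length ts" for h
    using pos[OF that] by (simp add: u_def)
  have a_nonneg: "0 \<le> a h" if "h \<in> H" for h
    using that pos[of h] by (simp add: a_def H_def)
  have fin: "finite H"
    by (simp add: H_def)
  have demand: "t < c + (\<Sum>h\<in>H. 2 * u h * a h) + (\<Sum>h\<in>{h\<in>H. a h < t}. u h * a h)"
    if t: "0 < t" "t \<le> T" for t
  proof -
    \<comment> \<open>If \<open>t \<le> a h\<close>, then \<open>t\<close> plus one period is at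
      most \<open>m h + 1\<close> periods. Otherwise
      \<open>t \<le> T < a h + period (ts ! h)\<close> costs one more.\<close>
    define n where "n h = (if a h < t then m h + 2 else m h + 1)" for h
    have unf: "\<not> finished \<sigma> i j (release j + t)"
    proof
      assume f: "finished \<sigma> i j (release j + t)"
      have "finished \<sigma> i j (release j + period (ts ! i))"
        unfolding finished_def
      proof
        fix v assume "v \<in> nodes j"
        then have "exec j v \<le> received \<sigma> (i, j, v) (release j + t)"
          using f by (simp add: finished_def)
        also have "\<dots> \<le> received \<sigma> (i, j, v) (release j + period (ts ! i))"
          using t by (intro received_mono) (simp add: T_def)
        finally show "exec j v \<le> received \<sigma> (i, j, v) (release j + period (ts ! i))" .
      qed
      then show False
        using miss by simp
    qed
    have "real M * t < real M * path_bound (ts ! i) + work_bound (ts ! i) +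
        (\<Sum>h | h < length ts \<and> prio h < prio i. real (n h) * work_bound (ts ! h))"
    proof (rule unfinished_demand[OF inj i j t(1) _ unf own higher _ M])
      show "t \<le> period (ts ! i)"
        using t by (simp add: T_def)
      show "t + period (ts ! h) \<le> real (n h) * period (ts ! h)" if "h < length ts" "prio h < prio i" for h
        using m(3)[of h] that t by (auto simp: n_def a_def H_def algebra_simps)
    qed
    also have "\<dots> = real M * c + (\<Sum>h\<in>H. real (n h) * work_bound (ts ! h))"
      using M by (simp add: c_def H_def algebra_simps)
    also have "\<dots> \<le> real M * c + (\<Sum>h\<in>H. real M * (2 * u h * a h + (if a h < t then u h * a h else 0)))"
    proof (intro add_left_mono sum_mono)
      fix h assume h: "h \<in> H"
      \<comment> \<open>Since \<open>1 \<le> m h\<close>, the counts \<open>m h + 1\<close> and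
        \<open>m h + 2\<close> are at most \<open>2 * m h\<close> and
        \<open>3 * m h\<close>.\<close>
      have "real (n h) \<le> real (m h) * (2 + (if a h < t then 1 else 0))"
        using m(1)[OF h] by (auto simp: n_def)
      then have "real (n h) * work_bound (ts ! h) \<le>
          real (m h) * (2 + (if a h < t then 1 else 0)) * work_bound (ts ! h)"
        using h pos(2)[of h] by (intro mult_right_mono) (auto simp: H_def)
      also have "\<dots> = (real M * u h * a h) * (2 + (if a h < t then 1 else 0))"
        using u_a[OF h] by simp
      also have "\<dots> = real M * (2 * u h * a h + (if a h < t then u h * a h else 0))"
        by (simp add: algebra_simps)
      finally show "real (n h) * work_bound (ts ! h) \<le>
        real M * (2 * u h * a h + (if a h < t then u h * a h else 0))" .
    qed
    also have "\<dots> = real M * (c + (\<Sum>h\<in>H. 2 * u h * a h) + (\<Sum>h\<in>{h\<in>H. a h < t}. u h * a h))"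
      using fin by (simp add: sum_distrib_left[symmetric] sum.distrib sum.inter_filter distrib_left)
    finally show ?thesis
      using M by simp
  qed
  have "0 \<le> path_bound (ts ! i)"
  proof -
    \<comment> \<open>The empty path has length 0, so the existence of a job forces a nonnegative
      path bound.\<close>
    have "sum (exec j) (set []) \<le> critical_path_length j"
      using job_valid_dag[OF i j] by (rule sum_path_le_critical_path_length) (simp add: dag_paths_def)
    then show ?thesis
      using job_of_task[OF i j] by (simp add: job_of_def)
  qed
  show False
  proof (rule demand_contradiction[OF fin, of u a x_star T "u i" c])
    show "0 < c"
      using \<open>0 \<le> path_bound (ts ! i)\<close> pos[OF i] M by (simp add: c_def add_nonneg_pos)
    show "c \<le> T * (x_star + u i)"
    proof -
      have "path_bound (ts ! i) \<le> T * x_star"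
        using bspec[OF paths nth_mem[OF i]] T by (simp add: T_def field_simps)
      moreover have "work_bound (ts ! i) / real M = T * u i"
        using T by (simp add: u_def T_def)
      ultimately show ?thesis
        by (simp add: c_def algebra_simps)
    qed
    have "u i + (\<Sum>h\<in>H. u h) = (\<Sum>h\<in>insert i H. u h)"
      using fin by (simp add: H_def)
    also have "\<dots> \<le> (\<Sum>h<length ts. u h)"
      using i u_nonneg by (intro sum_mono2) (auto simp: H_def)
    also have "\<dots> = (\<Sum>\<tau>\<leftarrow>ts. work_bound \<tau> / (real M * period \<tau>))"
      by (simp add: sum_list_sum_nth u_def atLeast0LessThan)
    finally show "u i + (\<Sum>h\<in>H. u h) \<le> x_star"
      using util by simp
    show "a h < c + (\<Sum>i\<in>H. 2 * u i * a i) + (\<Sum>i\<in>{i\<in>H. a i < a h}. u i * a i)" if "h \<in> H" for h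
      using demand[of "a h"] m[OF that] pos[of h] that by (simp add: a_def H_def)
    have "T < c + (\<Sum>h\<in>H. 2 * u h * a h) + (\<Sum>h\<in>{h\<in>H. a h < T}. u h * a h)"
      using demand[of T] T by simp
    also have "\<dots> \<le> c + (\<Sum>h\<in>H. 2 * u h * a h) + (\<Sum>h\<in>H. u h * a h)"
      using fin u_nonneg a_nonneg by (intro add_left_mono sum_mono2) (auto simp: H_def)
    also have "\<dots> = c + (\<Sum>h\<in>H. 3 * u h * a h)"
      by (simp add: ac_simps flip: sum.distrib)
    finally show "T < c + (\<Sum>h\<in>H. 3 * u h * a h)" .
  qed (use x_star_pos x_star_exp T u_nonneg a_nonneg i in \<open>auto simp: H_def\<close>)
qed

text \<open>Two nested inductions supply the hypotheses of \<open>meets_deadline\<close>: the outer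
  one over priorities, the inner one over earlier jobs of the same task.\<close>

lemma all_meet_deadlines:
  assumes rm: "rm_priority ts prio" and M: "1 \<le> M"
    and util: "(\<Sum>\<tau>\<leftarrow>ts. work_bound \<tau> / (real M * period \<tau>)) \<le> x_star"
    and paths: "\<forall>\<tau>\<in>set ts. path_bound \<tau> / period \<tau> \<le> x_star"
    and "i < length ts" "j \<in> J i"
  shows "finished \<sigma> i j (release j + period (ts ! i))"
  using assms(5,6)
proof (induction "prio i" arbitrary: i j rule: less_induct)
  case (less i)
  note i = less.prems(1) and higher = less.hyps
  show ?case
    using less.prems(2)
  \<comment> \<open>Real release times are not well-founded, so jobs are ranked by the release in
    whole periods. Separation by a full period makes this rank strictly increasing.\<close>
  proof (induction "nat \<lfloor>release j / period (ts ! i)\<rfloor>" arbitrary: j rule: less_induct)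
    case (less j)
    show ?case
    proof (rule meets_deadline[OF rm M util paths i less.prems _ higher])
      fix j' assume j': "j' \<in> J i" "release j' < release j"
      have p: "0 < period (ts ! i)"
        using period_pos[OF i] .
      have "period (ts ! i) \<le> \<bar>release j - release j'\<bar>"
        using pairwiseD[OF releases_separated[OF i] less.prems j'(1)] j'(2) by blast
      then have "release j' / period (ts ! i) + 1 \<le> release j / period (ts ! i)"
        using j' p by (simp add: le_divide_eq distrib_right)
      moreover have "0 \<le> release j' / period (ts ! i)"
        using job_of_task[OF i j'(1)] p by (simp add: job_of_def)
      ultimately have "nat \<lfloor>release j' / period (ts ! i)\<rfloor> < nat \<lfloor>release j / period (ts ! i)\<rfloor>"
        by linarith
      then show "finished \<sigma> i j' (release j' + period (ts ! i))"
        using less.hyps j'(1) by blast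
    qed
  qed
qed

end

theorem corollary4:
  shows "(\<exists>!x::real. 0 < x \<and> x = ln (3 / (2 + x))) \<and>
    \<bar>1 / x_star - 3.62143\<bar> < 0.000005 \<and>
    capacity_augmentation_factor global_rm_schedulable (1 / x_star)"
proof (intro conjI ex1_fixpoint inverse_x_star_approx)
  show "capacity_augmentation_factor global_rm_schedulable (1 / x_star)"
    unfolding capacity_augmentation_factor_def global_rm_schedulable_def
  proof (intro allI impI ballI, elim conjE)
    fix M ts prio J \<sigma> i j
    assume valid: "\<forall>\<tau>\<in>set ts. valid_task \<tau>"
      and arrivals: "legal_arrivals ts J" and sched: "priority_schedule M ts prio J \<sigma>"
      and rm: "rm_priority ts prio" "1 \<le> M"
      and "(\<Sum>\<tau>\<leftarrow>ts. work_bound \<tau> / (real M * period \<tau>)) \<le> 1 / (1 / x_star)"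
        "\<forall>\<tau>\<in>set ts. path_bound \<tau> / period \<tau> \<le> 1 / (1 / x_star)"
      and i: "i < length ts" "j \<in> J i"
    interpret priority_scheduled M ts prio J \<sigma>
      using valid arrivals sched by (rule priority_scheduled.intro)
    show "finished \<sigma> i j (release j + period (ts ! i))"
      using \<open>(\<Sum>\<tau>\<leftarrow>ts. _) \<le> _\<close> \<open>\<forall>\<tau>\<in>set ts. path_bound \<tau> / period \<tau> \<le> _\<close> i
      by (intro all_meet_deadlines[OF rm]) simp_all
  qed
qed

end
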